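(* Let $r\le d$ be positive integers. Then for every positive integer $s$, $$N_{d,r}(s)=\begin{cases} N_{d,1}(s), & 1\le s\le d,\\ N_{d,1}(s)+(r-1)\,N_{d,1}(s-2d), & s\ge d+1.\end{cases}$$
   Context: A partition $\lambda=(\lambda_1,\dots,\lambda_k)$ is a finite nonincreasing sequence of positive integers (the empty partition is allowed). In its Young diagram (row $i$ has $\lambda_i$ left-justified cells), the hook length $h(i,j)$ of cell $(i,j)$ is $1$ plus the number of cells to its right in its row plus the number of cells below it in its column. For a positive integer $t$, $\lambda$ is $t$-core if no cell has hook length $t$; it is $(s,s+r)$-core if it is both $s$-core and $(s+r)$-core. $\lambda$ has $d$-distinct parts if $\lambda_i-\lambda_{i+1}\ge d$ for all $1\le i\le k-1$. For positive integers $d,r,s$, $N_{d,r}(s)$ is the number of $(s,s+r)$-core partitions with $d$-distinct parts. A set $S\subseteq\mathbb{Z}$ is $d$-th order twin-free if $|x-y|>d$ for all distinct $x,y\in S$. For positive integers $r\le d$ and integers $s\le 0$, $N_{d,r}(s)$ is defined as the number of subsets $\beta\subseteq\{1,2,\dots,s+r-1\}$ (this set is empty if $s+r-1\le 0$) such that (1) $x-s\in\beta$ for all $x\in\beta$ with $x\ge s$; (2) $x-(s+r)\in\beta$ for all $x\in\beta$ with $x\ge s+r$; (3) $\beta$ is $d$-th order twin-free. (In particular, this is used for $N_{d,1}(s-2d)$ when $s-2d\le 0$.) *)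

theory Defs
  imports Main
begin

definition is_partition :: "nat list \<Rightarrow> bool" where
  "is_partition p \<longleftrightarrow> sorted_wrt (\<ge>) p \<and> (\<forall>x\<in>set p. 0 < x)"

text \<open>Rows and columns are indexed from 0, so cell \<open>(i, j)\<close> here is the cell
  \<open>(i + 1, j + 1)\<close> in the usual 1-based convention; hook lengths are unaffected.\<close>

definition young_diagram :: "nat list \<Rightarrow> (nat \<times> nat) set" where
  "young_diagram p = {(i, j). i < length p \<and> j < p ! i}"

definition hook_length :: "nat list \<Rightarrow> nat \<Rightarrow> nat \<Rightarrow> nat" where
  "hook_length p i j =
     1 + card {j'. j < j' \<and> (i, j') \<in> young_diagram p}
       + card {i'. i < i' \<and> (i', j) \<in> young_diagram p}"

definition is_core :: "nat \<Rightarrow> nat list \<Rightarrow> bool" where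
  "is_core t p \<longleftrightarrow> (\<forall>(i, j)\<in>young_diagram p. hook_length p i j \<noteq> t)"

text \<open>The condition \<open>d \<le> p\<^sub>i - p\<^sub>i\<^sub>+\<^sub>1\<close> is written additively to avoid truncated
  subtraction; the last part is not constrained.\<close>

definition distinct_parts :: "nat \<Rightarrow> nat list \<Rightarrow> bool" where
  "distinct_parts d p \<longleftrightarrow> (\<forall>i. Suc i < length p \<longrightarrow> p ! Suc i + d \<le> p ! i)"

definition twin_free :: "nat \<Rightarrow> int set \<Rightarrow> bool" where
  "twin_free d S \<longleftrightarrow> (\<forall>x\<in>S. \<forall>y\<in>S. x \<noteq> y \<longrightarrow> \<bar>x - y\<bar> > int d)"

text \<open>\<open>core_count d r s\<close> is $N_{d,r}(s)$. For \<open>0 < s\<close> it counts partitions; for \<open>s \<le> 0\<close>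
  it is by convention a count of sets of integers, meant for \<open>1 \<le> r \<le> d\<close>.\<close>

definition core_count :: "nat \<Rightarrow> nat \<Rightarrow> int \<Rightarrow> nat" where
  "core_count d r s =
     (if 0 < s
      then card {p. is_partition p \<and> is_core (nat s) p \<and> is_core (nat s + r) p
                    \<and> distinct_parts d p}
      else card {\<beta>. \<beta> \<subseteq> {1..s + int r - 1}
                    \<and> (\<forall>x\<in>\<beta>. s \<le> x \<longrightarrow> x - s \<in> \<beta>)
                    \<and> (\<forall>x\<in>\<beta>. s + int r \<le> x \<longrightarrow> x - (s + int r) \<in> \<beta>)
                    \<and> twin_free d \<beta>})"

end

theory Submission
  imports Defs
begin

text \<open>A partition is encoded by its set of first-column hook lengths, and it is a \<open>t\<close>-core iff
  subtracting \<open>t\<close> from an element of that set never lands on a nonnegative integer outside it.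
  For \<open>r \<le> d\<close> an element \<open>x \<ge> s + r\<close> would force both \<open>x - s\<close> and \<open>x - s - r\<close> into the set,
  which is too close; so the set lies below \<open>s + r\<close> and has at most one element above \<open>s\<close>. If that
  element is \<open>s + j\<close> with \<open>1 \<le> j < r\<close>, then \<open>j\<close> is in the set as well, and the remaining elements
  form an arbitrary twin-free subset of the interval strictly between \<open>j + d\<close> and \<open>s + j - d\<close>.\<close>

section \<open>Beta numbers (first-column hook lengths) and the conditions imposed on their
  sets\<close>

fun beta_list :: "nat list \<Rightarrow> nat list" where
  "beta_list [] = []"
| "beta_list (x # xs) = (x + length xs) # beta_list xs"

text \<open>Adjacent beta numbers differ by one more than the corresponding parts, so a part
  difference of at least \<open>d\<close> turns into a gap strictly larger than
  \<open>d\<close>.\<close>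

definition gapped :: "nat \<Rightarrow> nat set \<Rightarrow> bool" where
  "gapped d B \<longleftrightarrow> (\<forall>x\<in>B. \<forall>y\<in>B. x < y \<longrightarrow> x + d < y)"

definition core_set :: "nat \<Rightarrow> nat set \<Rightarrow> bool" where
  "core_set t B \<longleftrightarrow> (\<forall>x\<in>B. t \<le> x \<longrightarrow> x - t \<in> B)"

text \<open>The family that the case \<open>r = 1\<close> counts; it serves as the unit for the
  count at general \<open>r\<close>.\<close>

definition gapped_below :: "nat \<Rightarrow> nat \<Rightarrow> nat set set" where
  "gapped_below d m = {B. B \<subseteq> {1..<m} \<and> gapped d B}"

lemma length_beta_list [simp]: "length (beta_list p) = length p"
  by (induction p) auto

lemma nth_beta_list: "i < length p \<Longrightarrow> beta_list p ! i = p ! i + (length p - 1 - i)"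
proof (induction p arbitrary: i)
  case (Cons x xs)
  then show ?case by (cases i) auto
qed simp

lemma inj_beta_list: "inj beta_list"
proof (rule injI)
  fix p q assume "beta_list p = beta_list q"
  then show "p = q"
  proof (induction p arbitrary: q)
    case Nil
    then show ?case by (cases q) auto
  next
    case (Cons x xs)
    then obtain y ys where q: "q = y # ys" by (cases q) auto
    with Cons have "xs = ys" by auto
    with Cons q show ?case by auto
  qed
qed

section \<open>Hook lengths in terms of beta numbers\<close>

lemma antimono_pred_threshold:
  fixes n :: nat
  assumes "\<And>i k. i \<le> k \<Longrightarrow> k < n \<Longrightarrow> P k \<Longrightarrow> P i"
  obtains v where "v \<le> n" "\<And>i. i < n \<Longrightarrow> P i \<longleftrightarrow> i < v"
proof -
  \<comment> \<open>The disjunct \<open>n \<le> i\<close> makes the least index exist and caps it at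
    \<open>n\<close>.\<close>
  define v where "v = (LEAST i. n \<le> i \<or> \<not> P i)"
  have "v \<le> n" unfolding v_def by (rule Least_le) simp
  moreover have "n \<le> v \<or> \<not> P v" unfolding v_def by (rule LeastI[of _ n]) simp
  moreover have "P i" if "i < v" for i
    using not_less_Least[of i] that unfolding v_def by blast
  ultimately have "i < n \<Longrightarrow> P i \<longleftrightarrow> i < v" for i
    using assms[of v i] by (cases "i < v") auto
  with \<open>v \<le> n\<close> show thesis by (rule that)
qed

lemma is_partition_nth_mono:
  "is_partition p \<Longrightarrow> i \<le> k \<Longrightarrow> k < length p \<Longrightarrow> p ! k \<le> p ! i"
  unfolding is_partition_def sorted_wrt_iff_nth_less by (cases "i = k") auto

text \<open>Here \<open>v\<close> is the height of column \<open>j\<close>, so the arm is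
  \<open>p ! i - j - 1\<close> and the leg is \<open>v - i - 1\<close>.\<close>

lemma hook_length_eq:
  assumes "i < length p" "j < p ! i" and v: "v \<le> length p" "\<And>k. k < length p \<Longrightarrow> j < p ! k \<longleftrightarrow> k < v"
  shows "hook_length p i j = p ! i + v - j - i - 1" and "i < v"
proof -
  show "i < v" using assms by auto
  have "{j'. j < j' \<and> (i, j') \<in> young_diagram p} = {j<..<p ! i}"
    using assms by (auto simp: young_diagram_def)
  moreover have "{i'. i < i' \<and> (i', j) \<in> young_diagram p} = {i<..<v}"
    using v by (auto simp: young_diagram_def)
  ultimately show "hook_length p i j = p ! i + v - j - i - 1"
    using \<open>i < v\<close> \<open>j < p ! i\<close> by (simp add: hook_length_def)
qed

text \<open>With \<open>v\<close> the height of column \<open>j\<close>, the beta number of row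
  \<open>i\<close> minus the hook length is \<open>j + (length p - v)\<close>. Along the row these
  values run through exactly the naturals below that beta number which are not beta numbers.\<close>

lemma hook_length_in_row_iff:
  assumes p: "is_partition p" and i: "i < length p"
  shows "(\<exists>j<p ! i. hook_length p i j = t) \<longleftrightarrow>
    0 < t \<and> t \<le> beta_list p ! i \<and> beta_list p ! i - t \<notin> set (beta_list p)"
proof
  let ?n = "length p"
  assume "\<exists>j<p ! i. hook_length p i j = t"
  then obtain j where j: "j < p ! i" "hook_length p i j = t" by auto
  obtain v where v: "v \<le> ?n" "\<And>k. k < ?n \<Longrightarrow> j < p ! k \<longleftrightarrow> k < v"
    by (rule antimono_pred_threshold[of ?n "\<lambda>k. j < p ! k"])
      (auto dest: is_partition_nth_mono[OF p])
  note h = hook_length_eq[OF i j(1) v]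
  have b: "beta_list p ! i = p ! i + (?n - 1 - i)" using i by (rule nth_beta_list)
  have diff: "beta_list p ! i - t = j + (?n - v)"
    using h j b i v(1) by linarith
  \<comment> \<open>Rows \<open>k < v\<close> have part above \<open>j\<close> and at least
    \<open>?n - v\<close> rows below, so a larger beta number; rows \<open>k \<ge> v\<close> have
    part at most \<open>j\<close> and fewer rows below, so a smaller one.\<close>
  have "j + (?n - v) \<noteq> beta_list p ! k" if k: "k < ?n" for k
    using v(2)[OF k] v(1) k nth_beta_list[OF k] by (cases "k < v") linarith+
  then have "beta_list p ! i - t \<notin> set (beta_list p)"
    unfolding diff by (metis in_set_conv_nth length_beta_list)
  moreover have "0 < t \<and> t \<le> beta_list p ! i"
    using h j b i v(1) by linarith
  ultimately show "0 < t \<and> t \<le> beta_list p ! i \<and> beta_list p ! i - t \<notin> set (beta_list p)"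
    by blast
next
  let ?n = "length p"
  assume t: "0 < t \<and> t \<le> beta_list p ! i \<and> beta_list p ! i - t \<notin> set (beta_list p)"
  define x where "x = beta_list p ! i - t"
  have b: "beta_list p ! k = p ! k + (?n - 1 - k)" if "k < ?n" for k
    using that by (rule nth_beta_list)
  have anti: "x < beta_list p ! l" if "l \<le> k" "k < ?n" "x < beta_list p ! k" for l k
    using is_partition_nth_mono[OF p that(1,2)] b[of l] b[of k] that by linarith
  obtain v where v: "v \<le> ?n" "\<And>k. k < ?n \<Longrightarrow> x < beta_list p ! k \<longleftrightarrow> k < v"
    by (rule antimono_pred_threshold[of ?n "\<lambda>k. x < beta_list p ! k"]) (auto intro: anti)
  have x: "x \<noteq> beta_list p ! k" if "k < ?n" for k
    using t that by (auto simp: x_def in_set_conv_nth)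
  \<comment> \<open>chosen so that exactly the parts whose beta number exceeds \<open>x\<close> exceed \<open>j\<close>\<close>
  define j where "j = x - (?n - v)"
  \<comment> \<open>Since \<open>x\<close> is not a beta number, that of row \<open>v\<close> is
    strictly below \<open>x\<close>; this gains the unit from \<open>?n - 1 - v\<close> to
    \<open>?n - v\<close>.\<close>
  have low: "p ! v + (?n - v) \<le> x" if "v < ?n"
    using v(2)[OF that] x[OF that] b[OF that] that by auto
  have high: "x < p ! (v - 1) + (?n - v)" if "0 < v"
    using v(2)[of "v - 1"] b[of "v - 1"] v(1) that by auto
  have jx: "j + (?n - v) = x"
    using low v(1) by (cases "v < ?n") (auto simp: j_def)
  have jv: "j < p ! k \<longleftrightarrow> k < v" if k: "k < ?n" for k
  proof (cases "k < v")
    case True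
    then have "p ! (v - 1) \<le> p ! k" using is_partition_nth_mono[OF p, of k "v - 1"] v(1) by simp
    with True high jx show ?thesis by simp
  next
    case False
    then have "p ! k \<le> p ! v" using is_partition_nth_mono[OF p, of v k] k by simp
    with False low jx k show ?thesis by simp
  qed
  have "i < v" using v(2)[OF i] t by (auto simp: x_def)
  then have j: "j < p ! i" using jv i by simp
  have "hook_length p i j = t"
    using hook_length_eq[OF i j v(1) jv] b[OF i] jx v(1) i j t x_def by linarith
  with j show "\<exists>j<p ! i. hook_length p i j = t" by blast
qed

lemma is_core_iff_core_set:
  assumes p: "is_partition p" and t: "0 < t"
  shows "is_core t p \<longleftrightarrow> core_set t (set (beta_list p))"
proof -
  have "is_core t p \<longleftrightarrow> (\<forall>i<length p. \<not> (\<exists>j<p ! i. hook_length p i j = t))"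
    by (auto simp: is_core_def young_diagram_def)
  also have "\<dots> \<longleftrightarrow> (\<forall>i<length p. t \<le> beta_list p ! i \<longrightarrow> beta_list p ! i - t \<in> set (beta_list p))"
    using hook_length_in_row_iff[OF p] t by auto
  also have "\<dots> \<longleftrightarrow> core_set t (set (beta_list p))"
    unfolding core_set_def all_set_conv_all_nth by simp
  finally show ?thesis .
qed

section \<open>Partitions with \<open>d\<close>-distinct parts as gapped sets\<close>

lemma distinct_partition_Cons:
  "is_partition (x # xs) \<and> distinct_parts d (x # xs) \<longleftrightarrow>
    0 < x \<and> (xs \<noteq> [] \<longrightarrow> hd xs + d \<le> x) \<and> is_partition xs \<and> distinct_parts d xs"
proof (cases xs)
  case Nil
  then show ?thesis by (auto simp: is_partition_def distinct_parts_def)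
next
  case (Cons y ys)
  have "distinct_parts d (x # xs) \<longleftrightarrow> y + d \<le> x \<and> distinct_parts d xs"
    unfolding distinct_parts_def Cons by (auto simp: nth_Cons split: nat.splits)
  then show ?thesis using Cons by (force simp: is_partition_def)
qed

lemma distinct_partition_iff_beta_list:
  "is_partition p \<and> distinct_parts d p \<longleftrightarrow>
    sorted_wrt (\<lambda>a b. b + d < a) (beta_list p) \<and> 0 \<notin> set (beta_list p)"
proof (induction p)
  case Nil
  then show ?case by (simp add: is_partition_def distinct_parts_def)
next
  case (Cons x xs)
  \<comment> \<open>Transitivity reduces \<open>sorted_wrt\<close> to comparing adjacent
    entries.\<close>
  have tr: "transp (\<lambda>a b::nat. b + d < a)" by (auto intro!: transpI)
  show ?case
  proof (cases xs)
    case Nil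
    then show ?thesis using Cons by (auto simp: distinct_partition_Cons)
  next
    case (Cons y ys)
    have "is_partition (x # xs) \<and> distinct_parts d (x # xs) \<longleftrightarrow> 0 < x \<and> y + d \<le> x \<and>
      sorted_wrt (\<lambda>a b. b + d < a) (beta_list xs) \<and> 0 \<notin> set (beta_list xs)"
      using Cons.IH by (auto simp: distinct_partition_Cons Cons)
    \<comment> \<open>A nonzero head \<open>x + length xs\<close> does not give
      \<open>0 < x\<close>; that comes from \<open>0 < y\<close> and
      \<open>y + d \<le> x\<close>.\<close>
    moreover have "0 < y" if "is_partition xs" using that Cons by (simp add: is_partition_def)
    ultimately show ?thesis
      using Cons.IH by (auto simp: Cons sorted_wrt2[OF tr] simp del: sorted_wrt.simps(2))
  qed
qed

text \<open>The head exceeds \<open>length ys\<close> distinct positive numbers, so subtracting that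
  length to recover the part does not truncate.\<close>

lemma beta_list_surj:
  "sorted_wrt (>) ys \<Longrightarrow> 0 \<notin> set ys \<Longrightarrow> \<exists>p. beta_list p = ys"
proof (induction ys)
  case Nil
  show ?case by (rule exI[of _ "[]"]) simp
next
  case (Cons y ys)
  then obtain p where p: "beta_list p = ys" by auto
  have "set ys \<subseteq> {1..<y}" using Cons.prems by (auto simp: Suc_le_eq intro: gr0I)
  then have "card (set ys) \<le> y - 1" using card_mono[of "{1..<y}"] by simp
  moreover have "distinct ys" using Cons.prems by (induction ys) auto
  ultimately have "length p \<le> y" using p by (auto simp: distinct_card)
  then have "beta_list ((y - length p) # p) = y # ys" using p by simp
  then show ?case ..
qed

lemma sorted_wrt_gapped:
  "sorted_wrt (\<lambda>a b. b + d < a) ys \<longleftrightarrow> sorted_wrt (>) ys \<and> gapped d (set ys)"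
  by (induction ys) (auto simp: gapped_def)

lemma bij_betw_beta_set:
  "bij_betw (\<lambda>p. set (beta_list p)) {p. is_partition p \<and> distinct_parts d p}
    {B. finite B \<and> 0 \<notin> B \<and> gapped d B}"
proof (rule bij_betw_imageI)
  show "inj_on (\<lambda>p. set (beta_list p)) {p. is_partition p \<and> distinct_parts d p}"
  proof (rule inj_onI, clarsimp)
    fix p q assume "is_partition p" "distinct_parts d p" "is_partition q" "distinct_parts d q"
      and eq: "set (beta_list p) = set (beta_list q)"
    \<comment> \<open>A strictly monotone list is determined by its set; reversal makes the lists
      increasing.\<close>
    then have "sorted_wrt (<) (rev (beta_list p))" "sorted_wrt (<) (rev (beta_list q))"
      using distinct_partition_iff_beta_list sorted_wrt_gapped by (auto simp: sorted_wrt_rev)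
    then have "rev (beta_list p) = rev (beta_list q)"
      using eq strict_sorted_equal by fastforce
    then show "p = q" using inj_beta_list by (simp add: inj_eq)
  qed
  show "(\<lambda>p. set (beta_list p)) ` {p. is_partition p \<and> distinct_parts d p} =
    {B. finite B \<and> 0 \<notin> B \<and> gapped d B}" (is "?L = ?R")
  proof
    show "?L \<subseteq> ?R" using distinct_partition_iff_beta_list sorted_wrt_gapped by auto
    show "?R \<subseteq> ?L"
    proof
      fix B assume B: "B \<in> ?R"
      define ys where "ys = rev (sorted_list_of_set B)"
      have ys: "sorted_wrt (>) ys" "set ys = B" using B by (auto simp: ys_def sorted_wrt_rev)
      then obtain p where p: "beta_list p = ys" using beta_list_surj B by auto
      then have "is_partition p \<and> distinct_parts d p"
        using distinct_partition_iff_beta_list sorted_wrt_gapped ys B by auto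
      then show "B \<in> ?L" using p ys by force
    qed
  qed
qed

lemma core_count_eq_card_core_sets:
  assumes "0 < s"
  shows "core_count d r (int s) =
    card {B. finite B \<and> 0 \<notin> B \<and> gapped d B \<and> core_set s B \<and> core_set (s + r) B}"
proof -
  have "bij_betw (\<lambda>p. set (beta_list p))
    {p \<in> {p. is_partition p \<and> distinct_parts d p}. is_core s p \<and> is_core (s + r) p}
    {B \<in> {B. finite B \<and> 0 \<notin> B \<and> gapped d B}. core_set s B \<and> core_set (s + r) B}"
    by (rule bij_betw_Collect[OF bij_betw_beta_set]) (use assms in \<open>simp add: is_core_iff_core_set\<close>)
  from bij_betw_same_card[OF this] show ?thesis
    using assms by (simp add: core_count_def conj_ac)
qed

section \<open>Core sets with an element above \<open>s\<close>\<close>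

lemma finite_gapped_below [simp]: "finite (gapped_below d m)"
  unfolding gapped_below_def by (rule finite_subset[of _ "Pow {1..<m}"]) auto

lemma core_sets_subset:
  assumes "0 < r" "r \<le> d" "gapped d B" "core_set s B" "core_set (s + r) B"
  shows "B \<subseteq> {..<s + r}"
proof
  fix x assume x: "x \<in> B"
  show "x \<in> {..<s + r}"
  proof (rule ccontr)
    assume "x \<notin> {..<s + r}"
    then have "s + r \<le> x" by simp
    moreover from this \<open>0 < r\<close> have "x - (s + r) < x - s" by linarith
    moreover from \<open>s + r \<le> x\<close> x assms have "x - s \<in> B" "x - (s + r) \<in> B" by (auto simp: core_set_def)
    ultimately have "x - (s + r) + d < x - s"
      using assms(3) unfolding gapped_def by blast
    with \<open>s + r \<le> x\<close> assms(2) show False by linarith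
  qed
qed

text \<open>Shifting by \<open>j + d\<close> normalizes the free interval to
  \<open>{1..<s - 2 * d}\<close>, so the choices for \<open>C\<close> do not depend on
  \<open>j\<close>.\<close>

definition paired_set :: "nat \<Rightarrow> nat \<Rightarrow> nat \<Rightarrow> nat set \<Rightarrow> nat set" where
  "paired_set d s j C = insert j (insert (s + j) ((\<lambda>y. y + (j + d)) ` C))"

text \<open>Only \<open>s + j\<close> reaches \<open>s\<close>, because shifted elements stay below
  \<open>s + j - d < s\<close>. Hence the \<open>s\<close>-condition asks only for \<open>j\<close>,
  and the \<open>(s + r)\<close>-condition is vacuous by \<open>j < r\<close>.\<close>

lemma paired_set_core:
  assumes "0 < j" "j < r" "r \<le> d" "d < s" "C \<in> gapped_below d (s - 2 * d)"
  shows "gapped d (paired_set d s j C)" "core_set s (paired_set d s j C)"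
    "core_set (s + r) (paired_set d s j C)" "0 \<notin> paired_set d s j C" "finite (paired_set d s j C)"
    "\<And>x. x \<in> paired_set d s j C \<Longrightarrow> s \<le> x \<longleftrightarrow> x = s + j"
proof -
  have C: "C \<subseteq> {1..<s - 2 * d}" "gapped d C" using assms by (auto simp: gapped_below_def)
  have b: "1 \<le> y \<and> y + 2 * d < s" if "y \<in> C" for y using C that by force
  show g: "s \<le> x \<longleftrightarrow> x = s + j" if "x \<in> paired_set d s j C" for x
    using that assms b by (force simp: paired_set_def)
  show "finite (paired_set d s j C)" using C finite_subset by (auto simp: paired_set_def)
  show "0 \<notin> paired_set d s j C" using assms by (auto simp: paired_set_def)
  show "core_set s (paired_set d s j C)" using g by (auto simp: core_set_def paired_set_def)
  show "core_set (s + r) (paired_set d s j C)" unfolding core_set_def using g assms by fastforce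
  show "gapped d (paired_set d s j C)"
    using C(2) b assms unfolding gapped_def paired_set_def by fastforce
qed

lemma core_set_cases:
  assumes r: "0 < r" "r \<le> d" and s: "0 < s"
    and B: "0 \<notin> B" "gapped d B" "core_set s B" "core_set (s + r) B" and "\<not> B \<subseteq> {1..<s}"
  shows "d < s" and "\<exists>j\<in>{1..<r}. \<exists>C\<in>gapped_below d (s - 2 * d). B = paired_set d s j C"
proof -
  have sub: "B \<subseteq> {..<s + r}" using core_sets_subset r B by blast
  obtain x where x: "x \<in> B" "s \<le> x"
    using assms(4) \<open>\<not> B \<subseteq> {1..<s}\<close> by (fastforce simp: Suc_le_eq intro: gr0I)
  define j where "j = x - s"
  have xj: "x = s + j" and j: "j \<in> B" using x B by (auto simp: j_def core_set_def)
  have j0: "0 < j" using j B by (metis gr0I)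
  have jr: "j < r" using sub x xj by force
  have gap: "a + d < b" if "a \<in> B" "b \<in> B" "a < b" for a b
    using B that by (auto simp: gapped_def)
  \<comment> \<open>Both \<open>j\<close> and \<open>s + j\<close> lie in \<open>B\<close>, at
    distance \<open>s\<close>.\<close>
  show ds: "d < s" using gap[OF j x(1)] xj s by simp
  define C where "C = {y. 0 < y \<and> y < s - 2 * d \<and> y + (j + d) \<in> B}"
  have "C \<in> gapped_below d (s - 2 * d)"
    using gap by (fastforce simp: C_def gapped_below_def gapped_def)
  moreover have "B = paired_set d s j C"
  proof
    show "paired_set d s j C \<subseteq> B" using j x xj by (auto simp: paired_set_def C_def)
    show "B \<subseteq> paired_set d s j C"
    proof
      fix b assume b: "b \<in> B"
      show "b \<in> paired_set d s j C"
      proof (cases "b = j \<or> b = s + j")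
        case True
        then show ?thesis by (auto simp: paired_set_def)
      next
        case False
        \<comment> \<open>An element below \<open>j\<close> would need \<open>j > d\<close>, against
          \<open>j < r \<le> d\<close>.\<close>
        have "j + d < b" using gap[OF j b] gap[OF b j] False jr r by linarith
        \<comment> \<open>An element above \<open>s + j\<close> would exceed
          \<open>s + j + d\<close>, beyond the bound \<open>s + r\<close>.\<close>
        moreover have "b + d < s + j"
          using gap[OF b x(1)] gap[OF x(1) b] False sub b xj r by fastforce
        ultimately have "b - (j + d) \<in> C" "b = b - (j + d) + (j + d)"
          using b by (auto simp: C_def)
        then show ?thesis by (auto simp: paired_set_def)
      qed
    qed
  qed
  ultimately show "\<exists>j\<in>{1..<r}. \<exists>C\<in>gapped_below d (s - 2 * d). B = paired_set d s j C"
    using j0 jr by (intro bexI[of _ j] bexI[of _ C]) auto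
qed

text \<open>The unique element that is at least \<open>s\<close> reveals \<open>j\<close>; undoing
  the shift then recovers \<open>C\<close>.\<close>

lemma inj_paired_set:
  assumes "r \<le> d" "d < s"
  shows "inj_on (\<lambda>(j, C). paired_set d s j C) ({1..<r} \<times> gapped_below d (s - 2 * d))"
proof (rule inj_onI, clarify)
  fix j C k E
  assume j: "j \<in> {1..<r}" and k: "k \<in> {1..<r}"
    and C: "C \<in> gapped_below d (s - 2 * d)" and E: "E \<in> gapped_below d (s - 2 * d)"
    and eq: "paired_set d s j C = paired_set d s k E"
  have "s + j \<in> paired_set d s k E" unfolding eq[symmetric] by (simp add: paired_set_def)
  then have jk: "j = k" using paired_set_core(6)[of k r d s E "s + j"] k E assms by auto
  \<comment> \<open>The bounds on \<open>y\<close> filter out the pair: \<open>j\<close> would need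
    \<open>y + d = 0\<close>, and \<open>s + j\<close> would need \<open>y = s - d\<close>.\<close>
  have recover: "F = {y. 0 < y \<and> y + 2 * d < s \<and> y + (j + d) \<in> paired_set d s j F}"
    if "F \<in> gapped_below d (s - 2 * d)" for F
  proof -
    have "0 < y \<and> y + 2 * d < s" if "y \<in> F" for y
      using that \<open>F \<in> _\<close> by (force simp: gapped_below_def)
    then show ?thesis using j assms by (auto simp: paired_set_def)
  qed
  show "j = k \<and> C = E" using recover[OF C] recover[OF E] eq jk by simp
qed

section \<open>Counting the two kinds of core sets\<close>

lemma core_count_formula:
  assumes r: "0 < r" "r \<le> d" and s: "0 < s"
  shows "core_count d r (int s) = card (gapped_below d s) +
    (if s \<le> d then 0 else (r - 1) * card (gapped_below d (s - 2 * d)))"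
proof -
  define S where "S = {B. finite B \<and> 0 \<notin> B \<and> gapped d B \<and> core_set s B \<and> core_set (s + r) B}"
  \<comment> \<open>Below \<open>s\<close> both core conditions are vacuous.\<close>
  have below: "gapped_below d s \<subseteq> S"
    using finite_subset by (fastforce simp: S_def gapped_below_def core_set_def)
  show ?thesis
  proof (cases "s \<le> d")
    case True
    have "B \<subseteq> {1..<s}" if "B \<in> S" for B
      using core_set_cases(1)[OF r s, of B] that True by (auto simp: S_def)
    then have "S = gapped_below d s" using below by (auto simp: S_def gapped_below_def)
    then show ?thesis using True core_count_eq_card_core_sets[OF s] by (simp add: S_def)
  next
    case False
    let ?I = "{1..<r} \<times> gapped_below d (s - 2 * d)"
    let ?P = "(\<lambda>(j, C). paired_set d s j C) ` ?I"
    have "S = gapped_below d s \<union> ?P"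
    proof
      show "gapped_below d s \<union> ?P \<subseteq> S"
        using below paired_set_core(1-5)[of _ r d s] r False by (auto simp: S_def)
      show "S \<subseteq> gapped_below d s \<union> ?P"
      proof
        fix B assume B: "B \<in> S"
        show "B \<in> gapped_below d s \<union> ?P"
        proof (cases "B \<subseteq> {1..<s}")
          case True
          then show ?thesis using B by (simp add: S_def gapped_below_def)
        next
          case False
          then show ?thesis using core_set_cases(2)[OF r s, of B] B by (force simp: S_def)
        qed
      qed
    qed
    \<comment> \<open>A paired set contains \<open>s + j\<close>, which is not below
      \<open>s\<close>.\<close>
    moreover have "gapped_below d s \<inter> ?P = {}"
      by (auto simp: gapped_below_def paired_set_def)
    moreover have "card ?P = (r - 1) * card (gapped_below d (s - 2 * d))"
      using card_image[OF inj_paired_set[of r d s]] r False by (simp add: card_cartesian_product)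
    ultimately have "card S = card (gapped_below d s) + (r - 1) * card (gapped_below d (s - 2 * d))"
      by (simp add: card_Un_disjoint)
    then show ?thesis using False core_count_eq_card_core_sets[OF s] by (simp add: S_def)
  qed
qed

text \<open>For positive \<open>k\<close> the factor \<open>r - 1\<close> vanishes; for
  \<open>k \<le> 0\<close> both sides count only the empty set.\<close>

lemma core_count_one:
  assumes "0 < d"
  shows "core_count d 1 k = card (gapped_below d (nat k))"
proof (cases "0 < k")
  case True
  then show ?thesis using core_count_formula[of 1 d "nat k"] assms by simp
next
  case False
  then have "{\<beta>. \<beta> \<subseteq> {1..k + int 1 - 1} \<and> (\<forall>x\<in>\<beta>. k \<le> x \<longrightarrow> x - k \<in> \<beta>)
      \<and> (\<forall>x\<in>\<beta>. k + int 1 \<le> x \<longrightarrow> x - (k + int 1) \<in> \<beta>) \<and> twin_free d \<beta>} = {{}}"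
    by (auto simp: twin_free_def)
  moreover have "gapped_below d (nat k) = {{}}"
    using False by (auto simp: gapped_below_def gapped_def)
  ultimately show ?thesis using False unfolding core_count_def by simp
qed

theorem theorem2p9:
  fixes d r s :: nat
  assumes "0 < r" and "r \<le> d" and "0 < s"
  shows "core_count d r (int s) =
    (if s \<le> d then core_count d 1 (int s)
     else core_count d 1 (int s) + (r - 1) * core_count d 1 (int s - 2 * int d))"
proof -
  \<comment> \<open>Truncation at 0 matches the set convention for nonpositive arguments, covering
    \<open>s \<le> 2 * d\<close>.\<close>
  have "nat (int s - 2 * int d) = s - 2 * d" by linarith
  then show ?thesis
    using core_count_formula[OF assms] core_count_one[of d] assms by simp
qed

end
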